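(* Let $p$ be a prime, $q=p^r$ with $r\geq 1$, and let $\mathbb{F}_q=\{0,\alpha_1,\dots,\alpha_{q-1}\}$ (so $\alpha_1,\dots,\alpha_{q-1}$ is a fixed enumeration of the nonzero elements). Let $n$ and $k>1$ be positive integers and let $D=p^{\lfloor\log_p(k)\rfloor+1}$. Then $$ S_{\mathbb{F}_q}(\boldsymbol{e}_{n,k}) = \sum_{j_1=0}^{D-1}\sum_{j_2=0}^{j_1}\cdots \sum_{j_{q-1}=0}^{j_{q-2}} c_{j_1,\dots,j_{q-1}}(k)\left(1+\xi_D^{-j_1}+\cdots+\xi_D^{-j_{q-1}}\right)^n,$$ where $$c_{j_1,\dots,j_{q-1}}(k)=\frac{1}{D^{q-1}}\sum_{b_{q-1}=0}^{D-1}\cdots \sum_{b_1=0}^{D-1} \xi_p^{\mathrm{Tr}\left(F_{k;\mathbb{F}_q}^{(p)}(b_1,\dots,b_{q-1})\right)}\sum_{(j_1',\dots,j_{q-1}')\in \mathrm{Sym}(j_1,\dots, j_{q-1})}\xi_D^{j_1'b_{q-1}+\cdots+j_{q-1}' b_1}.$$ In particular, the sequence $\{S_{\mathbb{F}_q}(\boldsymbol{e}_{n,k})\}_n$ satisfies the linear recurrence with integer coefficients whose characteristic polynomial is $$P_{q,k}(X)=\prod_{a_1=0}^{D-1}\,\prod_{0\leq a_2\leq a_1} \cdots \prod_{0\leq a_{q-1}\leq a_{q-2}} \left(X-\left(1+\xi_D^{a_1}+\cdots+\xi_D^{a_{q-1}}\right)\right).$$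
   Context: $\boldsymbol{e}_{n,k}=\sum_{1\le i_1<\dots<i_k\le n}X_{i_1}\cdots X_{i_k}$ is the elementary symmetric polynomial of degree $k$ in $n$ variables. For $F:\mathbb{F}_q^n\to\mathbb{F}_q$, its exponential sum is $S_{\mathbb{F}_q}(F)=\sum_{\mathbf{x}\in\mathbb{F}_q^n}\exp\!\big(\tfrac{2\pi i}{p}\mathrm{Tr}(F(\mathbf{x}))\big)$, where $\mathrm{Tr}=\mathrm{Tr}_{\mathbb{F}_q/\mathbb{F}_p}$, $\mathrm{Tr}(\alpha)=\sum_{j=0}^{r-1}\alpha^{p^j}$, with values in $\mathbb{F}_p=\{0,\dots,p-1\}$. For a positive integer $m$, $\xi_m=\exp(2\pi i/m)$. $\mathrm{Sym}(j_1,\dots,j_{q-1})$ is the set of all distinct rearrangements (permutations of the entries) of the tuple $(j_1,\dots,j_{q-1})$. Define, for elements $a_1,a_2,\dots$ of $\mathbb{F}_q$, an integer $k$ and nonnegative integers $m_i$: $\Lambda_{a_1}(k,m)=a_1^k\binom{m}{k}$ (taken to be $0$ if $k<0$ or $k>m$; binomial coefficients are mapped into $\mathbb{F}_q$, and $a^0=1$), and recursively $\Lambda_{a_1,\dots,a_{l+1}}(k,m_1,\dots,m_{l+1})=\sum_{j=0}^{m_{l+1}}\binom{m_{l+1}}{j}a_{l+1}^j\Lambda_{a_1,\dots,a_l}(k-j,m_1,\dots,m_l)$. For integers $m_j$, set $m_j^+=m_j$ if $m_j>0$ and $m_j^+=m_j+(\lfloor -m_j/D\rfloor+1)D$ if $m_j\le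 0$, and define $F^{(p)}_{k;\mathbb{F}_q}(m_1,\dots,m_{q-1})=\Lambda_{\alpha_1,\dots,\alpha_{q-1}}(k,m_1^+,\dots,m_{q-1}^+)\in\mathbb{F}_q$. *)

theory Defs
  imports
    Complex_Main
    "HOL-Library.FuncSet"
    "HOL-Library.Cardinality"
    "HOL-Combinatorics.Permutations"
    "HOL-Computational_Algebra.Polynomial"
    "HOL-Computational_Algebra.Primes"
begin

text \<open>
  An \<open>N\<close>-tuple \<open>(x\<^sub>1, \<dots>, x\<^sub>N)\<close> is a function that is only relevant on \<open>{1..N}\<close>; where tuples
  are summed over, they range over extensional functions on \<open>{1..N}\<close>, so that each tuple is
  counted exactly once. The field \<open>\<bbbF>\<^sub>q\<close>, with \<open>q = p ^ r\<close>, is the type \<open>'a\<close>.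
\<close>

definition elem_sym :: "nat \<Rightarrow> nat \<Rightarrow> (nat \<Rightarrow> 'a::comm_ring_1) \<Rightarrow> 'a" where
  "elem_sym n k x = (\<Sum>I | I \<subseteq> {1..n} \<and> card I = k. \<Prod>i\<in>I. x i)"

definition xi :: "nat \<Rightarrow> complex" where
  "xi m = exp (2 * of_real pi * \<i> / of_nat m)"

definition field_trace :: "nat \<Rightarrow> nat \<Rightarrow> 'a::field \<Rightarrow> 'a" where
  "field_trace p r a = (\<Sum>j<r. a ^ (p ^ j))"

text \<open>
  The trace lies in the prime subfield; the following is its representative in
  \<open>{0, \<dots>, p - 1}\<close>, the identification being \<^const>\<open>of_nat\<close>.
\<close>

definition Tr :: "nat \<Rightarrow> nat \<Rightarrow> 'a::field \<Rightarrow> nat" where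
  "Tr p r a = (THE t. t < p \<and> of_nat t = field_trace p r a)"

definition exp_sum :: "nat \<Rightarrow> nat \<Rightarrow> nat \<Rightarrow> ((nat \<Rightarrow> 'a::{field,finite}) \<Rightarrow> 'a) \<Rightarrow> complex" where
  "exp_sum p r n f =
     (\<Sum>x\<in>{1..n} \<rightarrow>\<^sub>E UNIV. exp (2 * of_real pi * \<i> / of_nat p * of_nat (Tr p r (f x))))"

text \<open>
  \<open>Lambda l a k m\<close> is \<open>\<Lambda>\<close> with the \<open>l\<close> parameters \<open>a 1, \<dots>, a l\<close>, evaluated at
  \<open>(k, m 1, \<dots>, m l)\<close>. It is of interest for \<open>l \<ge> 1\<close> only; the value for \<open>l = 0\<close> is a convention.
\<close>

fun Lambda :: "nat \<Rightarrow> (nat \<Rightarrow> 'a::field) \<Rightarrow> int \<Rightarrow> (nat \<Rightarrow> nat) \<Rightarrow> 'a" where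
  "Lambda 0 a k m = (if k = 0 then 1 else 0)"
| "Lambda (Suc 0) a k m =
     (if k < 0 \<or> k > int (m 1) then 0 else a 1 ^ nat k * of_nat (m 1 choose nat k))"
| "Lambda (Suc (Suc l)) a k m =
     (\<Sum>j = 0..m (Suc (Suc l)). of_nat (m (Suc (Suc l)) choose j) * a (Suc (Suc l)) ^ j
        * Lambda (Suc l) a (k - int j) m)"

definition period :: "nat \<Rightarrow> nat \<Rightarrow> nat" where
  "period p k = p ^ (nat \<lfloor>log (real p) (real k)\<rfloor> + 1)"

definition pos_shift :: "nat \<Rightarrow> int \<Rightarrow> nat" where
  "pos_shift D m = nat (if m > 0 then m else m + (\<lfloor>real_of_int (- m) / real D\<rfloor> + 1) * int D)"

definition Fk :: "nat \<Rightarrow> nat \<Rightarrow> (nat \<Rightarrow> 'a::field) \<Rightarrow> nat \<Rightarrow> (nat \<Rightarrow> int) \<Rightarrow> 'a" where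
  "Fk p r \<alpha> k m = Lambda (p ^ r - 1) \<alpha> (int k) (\<lambda>i. pos_shift (period p k) (m i))"

definition tuples :: "nat \<Rightarrow> nat \<Rightarrow> (nat \<Rightarrow> nat) set" where
  "tuples N D = {1..N} \<rightarrow>\<^sub>E {0..<D}"

text \<open>
  The index set of the iterated sums and products over
  \<open>0 \<le> j\<^sub>1 \<le> D - 1\<close>, \<open>0 \<le> j\<^sub>2 \<le> j\<^sub>1\<close>, \dots, \<open>0 \<le> j\<^sub>N \<le> j\<^bsub>N-1\<^esub>\<close>.
\<close>

definition decreasing_tuples :: "nat \<Rightarrow> nat \<Rightarrow> (nat \<Rightarrow> nat) set" where
  "decreasing_tuples N D = {j \<in> tuples N D. \<forall>i\<in>{1..<N}. j (i + 1) \<le> j i}"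

definition Sym :: "nat \<Rightarrow> (nat \<Rightarrow> nat) \<Rightarrow> (nat \<Rightarrow> nat) set" where
  "Sym N j = {j \<circ> \<pi> |\<pi>. \<pi> permutes {1..N}}"

definition fourier_coeff :: "nat \<Rightarrow> nat \<Rightarrow> (nat \<Rightarrow> 'a::field) \<Rightarrow> nat \<Rightarrow> (nat \<Rightarrow> nat) \<Rightarrow> complex" where
  "fourier_coeff p r \<alpha> k j =
     (let q = p ^ r; D = period p k in
        1 / of_nat D ^ (q - 1) *
        (\<Sum>b\<in>tuples (q - 1) D. xi p ^ Tr p r (Fk p r \<alpha> k (\<lambda>i. int (b i))) *
           (\<Sum>j'\<in>Sym (q - 1) j. xi D ^ (\<Sum>i = 1..q - 1. j' i * b (q - i)))))"

definition char_poly :: "nat \<Rightarrow> nat \<Rightarrow> nat \<Rightarrow> complex poly" where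
  "char_poly p r k =
     (let q = p ^ r; D = period p k in
        \<Prod>a\<in>decreasing_tuples (q - 1) D. [:- (1 + (\<Sum>i = 1..q - 1. xi D ^ a i)), 1:])"

text \<open>
  The sequences of interest are indexed by the positive integers.
\<close>

definition satisfies_recurrence :: "(nat \<Rightarrow> complex) \<Rightarrow> complex poly \<Rightarrow> bool" where
  "satisfies_recurrence s P \<longleftrightarrow>
     lead_coeff P = 1 \<and>
     (\<forall>n\<ge>1. s (n + degree P) = - (\<Sum>i<degree P. coeff P i * s (n + i)))"

end

theory Submission
  imports Defs "HOL-Analysis.Complex_Transcendental"
begin

text \<open>
  The value \<open>e\<^bsub>n,k\<^esub>(x)\<close> is the coefficient of \<open>T ^ k\<close> in \<open>\<Prod>\<^sub>t (1 + x\<^sub>t T) = \<Prod>\<^sub>i (1 + \<alpha>\<^sub>i T) ^ m\<^sub>i\<close>, where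
  \<open>m\<^sub>i\<close> counts the occurrences of \<open>\<alpha>\<^sub>i\<close> in \<open>x\<close>. As \<open>D > k\<close> is a power of the characteristic,
  \<open>(1 + \<alpha> T) ^ D \<equiv> 1\<close> modulo \<open>T ^ D\<close>, so this coefficient depends only on the \<open>m\<^sub>i\<close> modulo \<open>D\<close>. Expanding
  it as a function on \<open>(\<int>/D)\<^bsup>q-1\<^esup>\<close> in a Fourier series, the sum over \<open>x\<close> of each character factors into
  an \<open>n\<close>-th power; characters that differ by a permutation give the same power.

  For \<open>t\<close> coprime to \<open>D\<close>, replacing \<open>\<xi>\<^sub>D\<close> by \<open>\<xi>\<^sub>D ^ t\<close> permutes the factors of \<open>P\<^bsub>q,k\<^esub>\<close>. Averaging a
  coefficient \<open>c\<close>, and likewise every power \<open>c ^ s\<close>, over these \<open>t\<close> shows that \<open>\<phi>(D) c ^ s\<close> is a combination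
  of Ramanujan sums and hence an integer for every \<open>s\<close>, which forces \<open>c\<close> to be an integer.
\<close>

subsection \<open>Elementary symmetric polynomials over a finite field\<close>

lemma coeff_one_linear_power:
  fixes a :: "'a::comm_ring_1"
  shows "coeff ([:1, a:] ^ m) i = of_nat (m choose i) * a ^ i"
proof (cases "i \<le> m")
  case True
  then show ?thesis by (simp add: coeff_linear_poly_power)
next
  case False
  have "degree ([:1, a:] ^ m) \<le> degree [:1, a:] * m"
    by (rule degree_power_le)
  also have "\<dots> \<le> 1 * m"
    by (intro mult_right_mono) simp_all
  finally show ?thesis
    using False by (simp add: coeff_eq_0 binomial_eq_0)
qed

text \<open>Each recursion step is the Cauchy product with one more factor
  \<open>(1 + a T) ^ m\<close>. The case \<open>k < 0\<close> is separate because
  \<open>nat k\<close> would turn it into the constant coefficient.\<close>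

lemma Lambda_eq_coeff:
  "Lambda l a k m = (if k < 0 then 0 else coeff (\<Prod>i = 1..l. [:1, a i:] ^ m i) (nat k))"
proof (induction l a k m rule: Lambda.induct)
  case (1 a k m)
  then show ?case by auto
next
  case (2 a k m)
  then show ?case
    by (auto simp: coeff_one_linear_power mult.commute binomial_eq_0 zless_nat_eq_int_zless)
next
  case (3 l a k m)
  let ?n = "Suc (Suc l)"
  let ?P = "\<Prod>i = 1..Suc l. [:1, a i:] ^ m i"
  show ?case
  proof (cases "k < 0")
    case True
    then show ?thesis using 3 by simp
  next
    case False
    have "coeff (\<Prod>i = 1..?n. [:1, a i:] ^ m i) (nat k) = coeff ([:1, a ?n:] ^ m ?n * ?P) (nat k)"
      by (simp add: mult_ac)
    also have "\<dots> = (\<Sum>j\<le>nat k. of_nat (m ?n choose j) * a ?n ^ j * coeff ?P (nat k - j))"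
      by (simp only: coeff_mult coeff_one_linear_power)
    also have "\<dots> = (\<Sum>j = 0..m ?n. of_nat (m ?n choose j) * a ?n ^ j
        * (if k - int j < 0 then 0 else coeff ?P (nat (k - int j))))"
    proof (rule sum.mono_neutral_cong)
      fix j assume "j \<in> {..nat k} \<inter> {0..m ?n}"
      then show "of_nat (m ?n choose j) * a ?n ^ j * coeff ?P (nat k - j) =
          of_nat (m ?n choose j) * a ?n ^ j
          * (if k - int j < 0 then 0 else coeff ?P (nat (k - int j)))"
        using False by (auto simp: nat_diff_distrib' le_nat_iff)
    qed (use False in \<open>auto simp: binomial_eq_0 not_le\<close>)
    also have "\<dots> = Lambda ?n a k m"
      unfolding Lambda.simps by (intro sum.cong refl arg_cong2[where f = "(*)"] 3[symmetric])
    finally show ?thesis using False by simp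
  qed
qed

text \<open>Expanding the product, the choice of \<open>x t T\<close> for exactly the
  \<open>t\<close> in \<open>I\<close> yields a monomial of degree \<open>card I\<close>.\<close>

lemma elem_sym_eq_coeff: "elem_sym n k x = coeff (\<Prod>t = 1..n. [:1, x t:]) k"
proof -
  have m: "(\<Prod>i\<in>I. monom (x i) 1) = monom (\<Prod>i\<in>I. x i) (card I)" if "finite I" for I :: "nat set"
    using that by induction (simp_all add: mult_monom)
  have "(\<Prod>t = 1..n. [:1, x t:]) = (\<Prod>t = 1..n. monom (x t) 1 + 1)"
    by (simp add: monom_altdef one_pCons)
  also have "\<dots> = (\<Sum>I\<in>Pow {1..n}. monom (\<Prod>i\<in>I. x i) (card I))"
    unfolding prod_add[OF finite_atLeastAtMost]
    by (intro sum.cong refl) (use m in \<open>simp add: finite_subset[OF _ finite_atLeastAtMost]\<close>)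
  also have "coeff \<dots> k = (\<Sum>I\<in>Pow {1..n}. if card I = k then \<Prod>i\<in>I. x i else 0)"
    by (simp add: coeff_sum)
  also have "\<dots> = elem_sym n k x"
    unfolding elem_sym_def by (subst sum.inter_filter[symmetric]) (auto intro!: sum.cong)
  finally show ?thesis ..
qed

section \<open>Congruence modulo \<open>T ^ D\<close> and periodicity in the exponents\<close>

text \<open>Congruence modulo \<open>T ^ D\<close>. Only coefficients below \<open>D\<close> enter a
  Cauchy product below \<open>D\<close>, hence the compatibility with products.\<close>

definition eq_upto :: "nat \<Rightarrow> 'a::comm_semiring_1 poly \<Rightarrow> 'a poly \<Rightarrow> bool" where
  "eq_upto D P Q \<longleftrightarrow> (\<forall>i<D. coeff P i = coeff Q i)"

lemma eq_upto_mult: "eq_upto D P Q \<Longrightarrow> eq_upto D P' Q' \<Longrightarrow> eq_upto D (P * P') (Q * Q')"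
  unfolding eq_upto_def coeff_mult by (auto intro!: sum.cong)

lemma eq_upto_power: "eq_upto D P Q \<Longrightarrow> eq_upto D (P ^ m) (Q ^ m)"
  by (induction m) (auto intro: eq_upto_mult simp: eq_upto_def[of _ 1])

lemma eq_upto_prod:
  "(\<And>i. i \<in> I \<Longrightarrow> eq_upto D (P i) (Q i)) \<Longrightarrow> eq_upto D (prod P I) (prod Q I)"
  by (induction I rule: infinite_finite_induct) (auto intro: eq_upto_mult simp: eq_upto_def[of _ 1])

text \<open>Translation by 1 permutes the field, so summing all elements gives
  \<open>q * 1 = 0\<close>; the prime characteristic therefore divides \<open>p ^ r\<close>.\<close>

lemma CHAR_eq_prime:
  fixes p r :: nat
  assumes "prime p" and "CARD('a::{field,finite}) = p ^ r"
  shows "CHAR('a) = p"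
proof -
  have "prime CHAR('a)"
    using prime_CHAR_semidom[where ?'a = 'a] finite_imp_CHAR_pos[where ?'a = 'a] by simp
  moreover have "CHAR('a) dvd p ^ r"
  proof -
    have "(\<Sum>x\<in>(UNIV :: 'a set). x + 1) = (\<Sum>x\<in>UNIV. x)"
      by (rule sum.reindex_bij_witness[of _ "\<lambda>x. x - 1" "\<lambda>x. x + 1"]) auto
    then have "of_nat CARD('a) = (0 :: 'a)"
      by (simp add: sum.distrib)
    then show ?thesis
      using assms by (simp only: of_nat_eq_0_iff_char_dvd)
  qed
  ultimately show ?thesis
    using assms prime_dvd_power primes_dvd_imp_eq by blast
qed

text \<open>The freshman's dream is applied in the polynomial ring, so its characteristic is
  required. It divides the prime \<open>CHAR('a)\<close> and is not 1.\<close>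

lemma CHAR_poly: "CHAR('a::{field,finite} poly) = CHAR('a)"
proof -
  have "prime CHAR('a)"
    using prime_CHAR_semidom[where ?'a = 'a] finite_imp_CHAR_pos[where ?'a = 'a] by simp
  moreover have "CHAR('a poly) dvd CHAR('a)"
    by (simp flip: of_nat_eq_0_iff_char_dvd add: of_nat_poly)
  moreover have "CHAR('a poly) \<noteq> 1"
    using CHAR_not_1'[where ?'a = "'a poly"] by simp
  ultimately show ?thesis
    using prime_nat_iff by blast
qed

lemma linear_power_eq_upto:
  fixes a :: "'a::{field,finite}"
  assumes D: "D = CHAR('a) ^ e" and "m mod D = m' mod D"
  shows "eq_upto D ([:1, a:] ^ m) ([:1, a:] ^ m')"
proof -
  have "prime CHAR('a)"
    using prime_CHAR_semidom[where ?'a = 'a] finite_imp_CHAR_pos[where ?'a = 'a] by simp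
  then have "(1 + monom a 1) ^ D = 1 ^ D + monom a 1 ^ D"
    by (intro freshmans_dream') (simp_all add: D CHAR_poly)
  then have "[:1, a:] ^ D = 1 + monom (a ^ D) D"
    by (simp add: monom_power) (simp add: monom_altdef one_pCons)
  then have 1: "eq_upto D ([:1, a:] ^ D) 1"
    by (simp add: eq_upto_def)
  have *: "eq_upto D ([:1, a:] ^ m) ([:1, a:] ^ (m mod D))" for m
  proof -
    have "[:1, a:] ^ m = ([:1, a:] ^ D) ^ (m div D) * [:1, a:] ^ (m mod D)"
      by (simp flip: power_mult power_add)
    moreover have "eq_upto D \<dots> (1 ^ (m div D) * [:1, a:] ^ (m mod D))"
      by (intro eq_upto_mult eq_upto_power 1) (simp add: eq_upto_def)
    ultimately show ?thesis by simp
  qed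
  show ?thesis
    using *[of m] *[of m'] assms(2) by (simp add: eq_upto_def)
qed

text \<open>This bound puts the coefficient of \<open>T ^ k\<close> among those that congruence
  modulo \<open>T ^ D\<close> preserves.\<close>

lemma less_period:
  assumes "p > 1" and "k > 0"
  shows "k < period p k"
proof -
  let ?e = "nat \<lfloor>log (real p) (real k)\<rfloor> + 1"
  have "log (real p) (real k) < real ?e"
    by linarith
  then have "real k < real p powr real ?e"
    using assms by (simp add: log_less_iff)
  also have "\<dots> = real (period p k)"
    using assms by (simp add: period_def powr_realpow del: of_nat_Suc)
  finally show ?thesis by simp
qed

text \<open>Only \<open>b = 0\<close> is moved, namely to \<open>D\<close>.\<close>

lemma pos_shift_mod:
  assumes "b < D"
  shows "pos_shift D (int b) mod D = b"
  using assms by (cases "b = 0") (auto simp: pos_shift_def)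

lemma Fk_eq_coeff:
  fixes \<alpha> :: "nat \<Rightarrow> 'a::{field,finite}"
  assumes "prime p" and "CARD('a) = p ^ r" and "k > 0"
    and b: "\<And>i. i \<in> {1..p ^ r - 1} \<Longrightarrow> b i = m i mod period p k"
  shows "Fk p r \<alpha> k (\<lambda>i. int (b i)) = coeff (\<Prod>i = 1..p ^ r - 1. [:1, \<alpha> i:] ^ m i) k"
proof -
  let ?D = "period p k"
  have k: "k < ?D"
    using assms by (intro less_period prime_gt_1_nat)
  have "eq_upto ?D (\<Prod>i = 1..p ^ r - 1. [:1, \<alpha> i:] ^ pos_shift ?D (int (b i)))
      (\<Prod>i = 1..p ^ r - 1. [:1, \<alpha> i:] ^ m i)"
  proof (intro eq_upto_prod linear_power_eq_upto)
    show "?D = CHAR('a) ^ (nat \<lfloor>log (real p) (real k)\<rfloor> + 1)"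
      using CHAR_eq_prime[OF assms(1,2)] by (simp add: period_def)
    fix i assume "i \<in> {1..p ^ r - 1}"
    then show "pos_shift ?D (int (b i)) mod ?D = m i mod ?D"
      using b k by (simp add: pos_shift_mod)
  qed
  then show ?thesis
    using k by (simp add: Fk_def Lambda_eq_coeff eq_upto_def)
qed

text \<open>Collect the positions by value; \<open>f 0 = 1\<close> lets the fibre over 0 drop out,
  since \<open>\<alpha>\<close> enumerates only the nonzero elements.\<close>

lemma prod_by_fibres:
  fixes f :: "'a::{field,finite} \<Rightarrow> 'b::comm_monoid_mult" and x :: "nat \<Rightarrow> 'a"
  assumes \<alpha>: "bij_betw \<alpha> {1..N} (UNIV - {0})" and "f 0 = 1"
  shows "(\<Prod>t = 1..n. f (x t)) = (\<Prod>i = 1..N. f (\<alpha> i) ^ card {t \<in> {1..n}. x t = \<alpha> i})"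
proof -
  have "(\<Prod>t = 1..n. f (x t)) = (\<Prod>y\<in>UNIV. \<Prod>t | t \<in> {1..n} \<and> x t = y. f (x t))"
    by (rule prod.group[symmetric]) simp_all
  also have "\<dots> = (\<Prod>y\<in>UNIV. f y ^ card {t \<in> {1..n}. x t = y})"
    by (intro prod.cong refl) simp
  also have "\<dots> = (\<Prod>y\<in>UNIV - {0}. f y ^ card {t \<in> {1..n}. x t = y})"
    using assms(2) by (intro prod.mono_neutral_right) auto
  also have "\<dots> = (\<Prod>i = 1..N. f (\<alpha> i) ^ card {t \<in> {1..n}. x t = \<alpha> i})"
    by (rule prod.reindex_bij_betw[OF \<alpha>, symmetric])
  finally show ?thesis .
qed

lemma elem_sym_eq_Fk:
  fixes \<alpha> :: "nat \<Rightarrow> 'a::{field,finite}"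
  assumes "prime p" and "CARD('a) = p ^ r" and "k > 0"
    and \<alpha>: "bij_betw \<alpha> {1..p ^ r - 1} (UNIV - {0})"
    and "\<And>i. i \<in> {1..p ^ r - 1} \<Longrightarrow> b i = card {t \<in> {1..n}. x t = \<alpha> i} mod period p k"
  shows "elem_sym n k x = Fk p r \<alpha> k (\<lambda>i. int (b i))"
  using Fk_eq_coeff[OF assms(1-3,5), where \<alpha> = \<alpha>] prod_by_fibres[OF \<alpha>, of "\<lambda>y. [:1, y:]" x n]
  by (simp add: elem_sym_eq_coeff one_pCons)

subsection \<open>Roots of unity and Fourier inversion\<close>

lemma xi_power: "xi D ^ n = exp (2 * of_real pi * \<i> * of_nat n / of_nat D)"
  by (simp add: xi_def exp_of_nat_mult[symmetric] mult_ac)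

lemma xi_power_eq_iff: "D > 0 \<Longrightarrow> xi D ^ m = xi D ^ n \<longleftrightarrow> m mod D = n mod D"
  unfolding xi_power by (rule complex_root_unity_eq) simp

lemma xi_power_mod: "D > 0 \<Longrightarrow> xi D ^ (n mod D) = xi D ^ n"
  by (simp add: xi_power_eq_iff)

lemma xi_nonzero [simp]: "xi D \<noteq> 0"
  by (simp add: xi_def)

lemma sum_xi_orthogonal:
  assumes "D > 0"
  shows "(\<Sum>j\<in>{0..<D}. xi D ^ (j * b) * inverse (xi D) ^ (j * m))
    = (if b mod D = m mod D then of_nat D else 0)"
proof -
  define z where "z = xi D ^ b * inverse (xi D) ^ m"
  have z1: "z = 1 \<longleftrightarrow> b mod D = m mod D"
    using xi_power_eq_iff[OF assms, of b m] by (simp add: z_def field_simps)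
  have D: "xi D ^ (D * n) = 1" for n
    using xi_power_eq_iff[OF assms, of "D * n" 0] by simp
  have "z ^ D = 1"
    by (simp add: z_def power_mult_distrib D mult.commute[of _ D] power_inverse flip: power_mult)
  have "(\<Sum>j\<in>{0..<D}. xi D ^ (j * b) * inverse (xi D) ^ (j * m)) = (\<Sum>j<D. z ^ j)"
    by (simp add: z_def power_mult_distrib atLeast0LessThan mult.commute flip: power_mult)
  also have "\<dots> = (if z = 1 then of_nat D else 0)"
    by (simp add: geometric_sum \<open>z ^ D = 1\<close>)
  finally show ?thesis by (simp only: z1)
qed

lemma finite_tuples [simp]: "finite (tuples N D)"
  by (simp add: tuples_def finite_PiE)

text \<open>
  The frequency \<open>j i\<close> is paired with the entry of index \<open>N + 1 - i\<close>, as in \<^const>\<open>fourier_coeff\<close>.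
\<close>

lemma fourier_inversion:
  fixes H :: "(nat \<Rightarrow> nat) \<Rightarrow> complex"
  assumes D: "D > 0"
  shows "H (\<lambda>i\<in>{1..N}. m i mod D) = (\<Sum>j\<in>tuples N D.
    (1 / of_nat D ^ N * (\<Sum>b\<in>tuples N D. H b * xi D ^ (\<Sum>i = 1..N. j i * b (Suc N - i))))
    * (\<Prod>i = 1..N. inverse (xi D) ^ (j i * m (Suc N - i))))"
proof -
  let ?m = "\<lambda>i\<in>{1..N}. m i mod D"
  have m: "?m \<in> tuples N D"
    using D by (auto simp: tuples_def)
  \<comment> \<open>Orthogonality of characters: the sum over tuples factors into one geometric sum
    per coordinate.\<close>
  have orth: "(\<Sum>j\<in>tuples N D. xi D ^ (\<Sum>i = 1..N. j i * b (Suc N - i))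
      * (\<Prod>i = 1..N. inverse (xi D) ^ (j i * m (Suc N - i)))) = (if b = ?m then of_nat D ^ N else 0)"
    if b: "b \<in> tuples N D" for b
  proof -
    have "(\<Sum>j\<in>tuples N D. xi D ^ (\<Sum>i = 1..N. j i * b (Suc N - i))
      * (\<Prod>i = 1..N. inverse (xi D) ^ (j i * m (Suc N - i))))
      = (\<Prod>i = 1..N. \<Sum>j\<in>{0..<D}. xi D ^ (j * b (Suc N - i)) * inverse (xi D) ^ (j * m (Suc N - i)))"
      unfolding tuples_def
      by (subst prod_sum_PiE) (simp_all add: power_sum prod.distrib)
    also have "\<dots> = (\<Prod>i = 1..N. if b (Suc N - i) mod D = m (Suc N - i) mod D then of_nat D else 0)"
      by (simp only: sum_xi_orthogonal[OF D])
    \<comment> \<open>The product over all coordinates is unchanged by the reflection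
      \<open>i -> N + 1 - i\<close>.\<close>
    also have "\<dots> = (\<Prod>i = 1..N. if b i mod D = m i mod D then of_nat D else 0)"
      using prod.atLeastAtMost_rev[of "\<lambda>i. if b i mod D = m i mod D then of_nat D else (0::complex)" 1 N]
      by simp
    also have "\<dots> = (if \<forall>i\<in>{1..N}. b i mod D = m i mod D then of_nat D ^ N else 0)"
      by (cases "\<forall>i\<in>{1..N}. b i mod D = m i mod D") (use D in \<open>auto simp: prod_zero_iff\<close>)
    also have "(\<forall>i\<in>{1..N}. b i mod D = m i mod D) \<longleftrightarrow> b = ?m"
    proof
      assume *: "\<forall>i\<in>{1..N}. b i mod D = m i mod D"
      have "b i = m i mod D" if "i \<in> {1..N}" for i
      proof -
        have "b i < D" using b that by (auto simp: tuples_def PiE_iff)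
        then show ?thesis using * that by (metis mod_less)
      qed
      then show "b = ?m"
        using b m by (intro PiE_ext[where k = "{1..N}"]) (auto simp: tuples_def)
    qed (use D in auto)
    finally show ?thesis .
  qed
  have "(\<Sum>j\<in>tuples N D.
      (1 / of_nat D ^ N * (\<Sum>b\<in>tuples N D. H b * xi D ^ (\<Sum>i = 1..N. j i * b (Suc N - i))))
      * (\<Prod>i = 1..N. inverse (xi D) ^ (j i * m (Suc N - i))))
    = (\<Sum>b\<in>tuples N D. 1 / of_nat D ^ N * H b *
       (\<Sum>j\<in>tuples N D. xi D ^ (\<Sum>i = 1..N. j i * b (Suc N - i))
      * (\<Prod>i = 1..N. inverse (xi D) ^ (j i * m (Suc N - i)))))"
    unfolding sum_distrib_left sum_distrib_right mult.assoc by (rule sum.swap)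
  also have "\<dots> = (\<Sum>b\<in>tuples N D. if b = ?m then H b else 0)"
    by (intro sum.cong refl, subst orth) (use D in auto)
  also have "\<dots> = H ?m"
    using m by simp
  finally show ?thesis ..
qed

text \<open>Give 0 the weight 1 and \<open>\<alpha> i\<close> the weight \<open>w i\<close>: the
  weight of a tuple is multiplicative over its coordinates, so the sum is the \<open>n\<close>-th
  power of the total weight.\<close>

lemma sum_prod_fibres:
  fixes \<alpha> :: "nat \<Rightarrow> 'a::{field,finite}"
  assumes \<alpha>: "bij_betw \<alpha> {1..N} (UNIV - {0})"
  shows "(\<Sum>x\<in>{1..n} \<rightarrow>\<^sub>E UNIV. \<Prod>i = 1..N. w i ^ card {t \<in> {1..n}. x t = \<alpha> i})
    = (1 + (\<Sum>i = 1..N. w i) :: complex) ^ n"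
proof -
  define f where "f y = (if y = 0 then 1 else w (inv_into {1..N} \<alpha> y))" for y
  have f: "f (\<alpha> i) = w i" if "i \<in> {1..N}" for i
  proof -
    have "\<alpha> i \<noteq> 0" using bij_betwE[OF \<alpha>] that by blast
    moreover have "inv_into {1..N} \<alpha> (\<alpha> i) = i"
      using bij_betw_inv_into_left[OF \<alpha> that] .
    ultimately show ?thesis by (simp add: f_def)
  qed
  have "(\<Sum>y\<in>UNIV. f y) = f 0 + (\<Sum>y\<in>UNIV - {0}. f y)"
    by (rule sum.remove) auto
  also have "(\<Sum>y\<in>UNIV - {0}. f y) = (\<Sum>i = 1..N. f (\<alpha> i))"
    by (rule sum.reindex_bij_betw[OF \<alpha>, symmetric])
  also have "f 0 = 1" by (simp add: f_def)
  finally have "(1 + (\<Sum>i = 1..N. w i)) ^ n = (\<Sum>y\<in>UNIV. f y) ^ n"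
    by (simp add: f)
  also have "\<dots> = (\<Sum>x\<in>{1..n} \<rightarrow>\<^sub>E UNIV. \<Prod>t = 1..n. f (x t))"
    using prod_sum_PiE[of "{1..n}" "\<lambda>_. UNIV" "\<lambda>_. f"] by simp
  also have "\<dots> = (\<Sum>x\<in>{1..n} \<rightarrow>\<^sub>E UNIV. \<Prod>i = 1..N. w i ^ card {t \<in> {1..n}. x t = \<alpha> i})"
    by (intro sum.cong refl, subst prod_by_fibres[OF \<alpha>, where f = f])
      (simp_all add: f f_def[of 0] del: One_nat_def)
  finally show ?thesis ..
qed

subsection \<open>Tuples and multisets\<close>

abbreviation tuple_mset :: "nat \<Rightarrow> (nat \<Rightarrow> nat) \<Rightarrow> nat multiset" where
  "tuple_mset N j \<equiv> image_mset j (mset_set {1..N})"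

text \<open>These multisets label the rearrangement classes of tuples, free of any choice of
  order.\<close>

definition bounded_msets :: "nat \<Rightarrow> nat \<Rightarrow> nat multiset set" where
  "bounded_msets N D = {M. size M = N \<and> set_mset M \<subseteq> {0..<D}}"

lemma tuple_mset_eq_mset: "tuple_mset N j = mset (map j [1..<Suc N])"
proof -
  have "mset_set {1..N} = mset [1..<Suc N]"
    by (metis atLeastLessThanSuc_atLeastAtMost mset_upt)
  then show ?thesis by simp
qed

text \<open>A permutation exists exactly when the multisets agree; off \<open>{1..N}\<close> it is
  the identity and both tuples are \<open>undefined\<close>, so the equality holds as
  functions.\<close>

lemma mem_Sym_iff:
  assumes "j \<in> tuples N D"
  shows "j' \<in> Sym N j \<longleftrightarrow> j' \<in> tuples N D \<and> tuple_mset N j' = tuple_mset N j"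
proof
  assume "j' \<in> Sym N j"
  then obtain \<pi> where \<pi>: "\<pi> permutes {1..N}" "j' = j \<circ> \<pi>"
    by (auto simp: Sym_def)
  have "j' \<in> tuples N D"
    unfolding tuples_def
  proof (rule PiE_I)
    fix i assume "i \<in> {1..N}"
    then have "\<pi> i \<in> {1..N}" using \<pi>(1) permutes_in_image[OF \<pi>(1), of i] by simp
    then show "j' i \<in> {0..<D}"
      using assms \<pi>(2) by (auto simp: tuples_def PiE_iff)
  next
    fix i assume "i \<notin> {1..N}"
    then show "j' i = undefined"
      using assms \<pi>(2) permutes_not_in[OF \<pi>(1)] PiE_arb[of j "{1..N}" _ i] by (simp add: tuples_def)
  qed
  moreover have "tuple_mset N j = tuple_mset N j'"
    using permutes_implies_image_mset_eq[OF \<pi>(1), of j' j] \<pi>(2) by simp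
  ultimately show "j' \<in> tuples N D \<and> tuple_mset N j' = tuple_mset N j" by simp
next
  assume *: "j' \<in> tuples N D \<and> tuple_mset N j' = tuple_mset N j"
  obtain \<pi> where \<pi>: "\<pi> permutes {1..N}" "\<forall>i\<in>{1..N}. j' i = j (\<pi> i)"
    using image_mset_eq_implies_permutes[of "{1..N}" j' j] * by auto
  have "j' i = (j \<circ> \<pi>) i" for i
  proof (cases "i \<in> {1..N}")
    case True
    then show ?thesis using \<pi>(2) by (simp only: comp_apply)
  next
    case False
    then have "\<pi> i = i" "j i = undefined" "j' i = undefined"
      using * assms PiE_arb[OF _ False] permutes_not_in[OF \<pi>(1) False] by (auto simp only: tuples_def)
    then show ?thesis by (simp only: comp_apply)
  qed
  then have "j' = j \<circ> \<pi>" by (rule ext)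
  then show "j' \<in> Sym N j"
    using \<pi>(1) unfolding Sym_def by blast
qed

lemma tuple_mset_mem: "j \<in> tuples N D \<Longrightarrow> tuple_mset N j \<in> bounded_msets N D"
  by (auto simp: bounded_msets_def tuples_def PiE_iff)

lemma decreasing_tuples_iff:
  "j \<in> decreasing_tuples N D \<longleftrightarrow> j \<in> tuples N D \<and> sorted (rev (map j [1..<Suc N]))"
proof -
  have "sorted (rev (map j [1..<Suc N])) \<longleftrightarrow> (\<forall>i. Suc i < N \<longrightarrow> j (Suc (Suc i)) \<le> j (Suc i))"
    by (simp add: sorted_rev_iff_nth_Suc del: upt_Suc)
  also have "\<dots> \<longleftrightarrow> (\<forall>i\<in>{1..<N}. j (i + 1) \<le> j i)"
  proof safe
    fix i assume "\<forall>i. Suc i < N \<longrightarrow> j (Suc (Suc i)) \<le> j (Suc i)" "i \<in> {1..<N}"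
    then show "j (i + 1) \<le> j i" by (cases i) auto
  qed auto
  finally show ?thesis
    by (auto simp: decreasing_tuples_def)
qed

lemma bij_betw_decreasing_tuples:
  "bij_betw (tuple_mset N) (decreasing_tuples N D) (bounded_msets N D)"
  unfolding bij_betw_def
proof (intro conjI inj_onI equalityI subsetI)
  fix j j' assume *: "j \<in> decreasing_tuples N D" "j' \<in> decreasing_tuples N D"
    "tuple_mset N j = tuple_mset N j'"
  then have "rev (map j [1..<Suc N]) = rev (map j' [1..<Suc N])"
    unfolding decreasing_tuples_iff tuple_mset_eq_mset
    by (metis mset_rev properties_for_sort)
  then have "\<forall>i\<in>{1..N}. j i = j' i"
    by (auto simp del: upt_Suc)
  then show "j = j'"
    using * unfolding decreasing_tuples_iff tuples_def
    by (intro PiE_ext[where k = "{1..N}"]) auto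
next
  fix M assume "M \<in> tuple_mset N ` decreasing_tuples N D"
  then show "M \<in> bounded_msets N D"
    by (auto simp only: decreasing_tuples_iff tuple_mset_mem)
next
  fix M assume M: "M \<in> bounded_msets N D"
  define xs where "xs = rev (sorted_list_of_multiset M)"
  \<comment> \<open>List positions start at 0, tuple indices at 1.\<close>
  define j where "j = (\<lambda>i\<in>{1..N}. xs ! (i - 1))"
  have xs: "mset xs = M" "sorted (rev xs)"
    by (simp_all add: xs_def)
  then have len: "length xs = N"
    using M by (auto simp: bounded_msets_def simp flip: size_mset)
  have map: "map j [1..<Suc N] = xs"
    by (rule nth_equalityI) (auto simp: len j_def simp del: upt_Suc)
  have "j \<in> tuples N D"
    unfolding tuples_def
  proof (rule PiE_I)
    fix i assume "i \<in> {1..N}"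
    then have "j i \<in> set xs" by (auto simp: j_def len)
    then show "j i \<in> {0..<D}"
      using M xs(1) by (auto simp: bounded_msets_def simp flip: set_mset_mset)
  qed (auto simp: j_def)
  then have "j \<in> decreasing_tuples N D"
    by (simp only: decreasing_tuples_iff map xs)
  moreover have "tuple_mset N j = M"
    by (simp only: tuple_mset_eq_mset map xs)
  ultimately show "M \<in> tuple_mset N ` decreasing_tuples N D" by blast
qed

lemma finite_decreasing_tuples [simp]: "finite (decreasing_tuples N D)"
  by (rule finite_subset[of _ "tuples N D"]) (auto simp: decreasing_tuples_def)

text \<open>The classes \<open>Sym N j\<close> partition the tuples, with one decreasing
  representative each.\<close>

lemma sum_tuples_by_Sym:
  "(\<Sum>j\<in>tuples N D. f j) = (\<Sum>j\<in>decreasing_tuples N D. \<Sum>j'\<in>Sym N j. f j')"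
proof -
  have Sym: "Sym N j = {j' \<in> tuples N D. tuple_mset N j' = tuple_mset N j}"
    if "j \<in> decreasing_tuples N D" for j
    using that mem_Sym_iff by (auto simp only: decreasing_tuples_iff)
  have "tuples N D = (\<Union>j\<in>decreasing_tuples N D. Sym N j)"
  proof (intro equalityI subsetI)
    fix j' assume j': "j' \<in> tuples N D"
    then obtain j where "j \<in> decreasing_tuples N D" "tuple_mset N j' = tuple_mset N j"
      using bij_betw_decreasing_tuples[of N D] tuple_mset_mem[OF j']
      unfolding bij_betw_def by blast
    then show "j' \<in> (\<Union>j\<in>decreasing_tuples N D. Sym N j)"
      using Sym j' by blast
  qed (use Sym in blast)
  also have "sum f \<dots> = (\<Sum>j\<in>decreasing_tuples N D. \<Sum>j'\<in>Sym N j. f j')"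
  proof (rule sum.UNION_disjoint)
    show "\<forall>j\<in>decreasing_tuples N D. \<forall>j'\<in>decreasing_tuples N D. j \<noteq> j' \<longrightarrow> Sym N j \<inter> Sym N j' = {}"
      using bij_betw_imp_inj_on[OF bij_betw_decreasing_tuples, of N D]
      by (auto simp: Sym inj_on_def)
  qed (simp_all add: Sym)
  finally show ?thesis .
qed

text \<open>Applying \<open>h\<close> entrywise may destroy the decreasing order, so the product is
  moved to multisets, which \<open>h\<close> permutes; each factor depends only on the
  multiset.\<close>

lemma prod_decreasing_tuples_permuted:
  fixes F :: "'b::comm_monoid_add \<Rightarrow> 'c::comm_monoid_mult"
  assumes "bij_betw h {0..<D} {0..<D}"
  shows "(\<Prod>a\<in>decreasing_tuples N D. F (\<Sum>i = 1..N. g (h (a i))))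
    = (\<Prod>a\<in>decreasing_tuples N D. F (\<Sum>i = 1..N. g (a i)))"
proof -
  let ?h' = "inv_into {0..<D} h" and ?B = "bounded_msets N D"
  have inv: "?h' (h x) = x" "h (?h' x) = x" "h x < D" "?h' x < D" if "x < D" for x
    using assms that
    by (auto dest: bij_betw_inv_into_left bij_betw_inv_into_right bij_betwE bij_betwE[OF bij_betw_inv_into])
  have bij: "bij_betw (image_mset h) ?B ?B"
    by (rule bij_betw_byWitness[where f' = "image_mset ?h'"])
      (auto simp: bounded_msets_def subset_iff inv multiset.map_comp
        intro!: multiset.map_ident_strong)
  have "(\<Prod>a\<in>decreasing_tuples N D. F (\<Sum>i = 1..N. g (k (a i))))
      = (\<Prod>M\<in>?B. F (\<Sum>x\<in>#image_mset k M. g x))" for k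
    using prod.reindex_bij_betw[OF bij_betw_decreasing_tuples,
        of "\<lambda>M. F (\<Sum>x\<in>#image_mset k M. g x)" N D]
    by (simp add: multiset.map_comp comp_def sum_unfold_sum_mset)
  from this[of h] this[of "\<lambda>x. x"] show ?thesis
    using prod.reindex_bij_betw[OF bij, of "\<lambda>M. F (\<Sum>x\<in>#M. g x)"] by simp
qed

subsection \<open>Integrality\<close>

text \<open>
  An element of \<open>cyclotomic_orbits D\<close> records the conjugates \<open>f t = \<sigma>\<^sub>t (f 1)\<close> of an integer
  combination \<open>f 1\<close> of powers of \<^term>\<open>xi D\<close>, where \<open>\<sigma>\<^sub>t\<close> maps \<^term>\<open>xi D\<close> to \<^term>\<open>xi D ^ t\<close>
  for \<open>t\<close> coprime to \<open>D\<close>.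
\<close>

inductive_set cyclotomic_orbits :: "nat \<Rightarrow> (nat \<Rightarrow> complex) set" for D where
  zero: "(\<lambda>t. 0) \<in> cyclotomic_orbits D"
| add_term: "f \<in> cyclotomic_orbits D \<Longrightarrow>
    (\<lambda>t. f t + of_int c * xi D ^ (t * a)) \<in> cyclotomic_orbits D"

lemma cyclotomic_orbits_const: "(\<lambda>t. of_int c) \<in> cyclotomic_orbits D"
  using add_term[OF zero, where c = c and a = 0] by simp

lemma cyclotomic_orbits_xi: "(\<lambda>t. xi D ^ (t * a)) \<in> cyclotomic_orbits D"
  using add_term[OF zero, where c = 1 and a = a] by simp

lemma cyclotomic_orbits_add:
  assumes "f \<in> cyclotomic_orbits D" and "g \<in> cyclotomic_orbits D"
  shows "(\<lambda>t. f t + g t) \<in> cyclotomic_orbits D"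
  using assms(2)
proof induction
  case (add_term g c a)
  then show ?case
    using cyclotomic_orbits.add_term[OF add_term.IH, where c = c and a = a] by (simp add: add.assoc)
qed (use assms(1) in simp)

lemma cyclotomic_orbits_mult:
  assumes "f \<in> cyclotomic_orbits D" and "g \<in> cyclotomic_orbits D"
  shows "(\<lambda>t. f t * g t) \<in> cyclotomic_orbits D"
  using assms(2)
proof induction
  case zero
  then show ?case using cyclotomic_orbits.zero by simp
next
  case (add_term g c a)
  from assms(1) have "(\<lambda>t. f t * (of_int c * xi D ^ (t * a))) \<in> cyclotomic_orbits D"
  proof induction
    case zero
    then show ?case using cyclotomic_orbits.zero by simp
  next
    case (add_term f c' a')
    have "(f t + of_int c' * xi D ^ (t * a')) * (of_int c * xi D ^ (t * a))
        = f t * (of_int c * xi D ^ (t * a)) + of_int (c' * c) * xi D ^ (t * (a' + a))" for t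
      by (simp add: algebra_simps power_add)
    then show ?case
      using cyclotomic_orbits.add_term[OF add_term.IH, where c = "c' * c" and a = "a' + a"]
      by (simp only:)
  qed
  from cyclotomic_orbits_add[OF add_term.IH this] show ?case
    by (simp add: distrib_left)
qed

lemma cyclotomic_orbits_uminus:
  "f \<in> cyclotomic_orbits D \<Longrightarrow> (\<lambda>t. - f t) \<in> cyclotomic_orbits D"
  using cyclotomic_orbits_mult[OF cyclotomic_orbits_const[of "-1"]] by simp

lemma cyclotomic_orbits_power:
  "f \<in> cyclotomic_orbits D \<Longrightarrow> (\<lambda>t. f t ^ s) \<in> cyclotomic_orbits D"
  using cyclotomic_orbits_const[of 1 D]
  by (induction s) (auto intro: cyclotomic_orbits_mult)

lemma cyclotomic_orbits_sum:
  "(\<And>i. i \<in> I \<Longrightarrow> f i \<in> cyclotomic_orbits D) \<Longrightarrow> (\<lambda>t. \<Sum>i\<in>I. f i t) \<in> cyclotomic_orbits D"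
  by (induction I rule: infinite_finite_induct)
    (auto intro: cyclotomic_orbits_add cyclotomic_orbits.zero)

section \<open>Ramanujan sums and traces\<close>

lemma sum_xi_Ints: "(\<Sum>t\<in>{0..<D}. xi D ^ (t * a)) \<in> \<int>"
proof (cases "D = 0")
  case False
  then show ?thesis
    using sum_xi_orthogonal[of D a 0] by simp
qed simp

text \<open>The residues not coprime to \<open>p ^ e\<close> are the multiples of \<open>p\<close>.
  On them \<open>xi (p ^ e) ^ p = xi (p ^ (e - 1))\<close> leaves a complete sum again, so the
  result is a difference of two integers.\<close>

lemma ramanujan_sum_Ints:
  assumes p: "prime p" and e: "e > 0"
  shows "(\<Sum>t | t < p ^ e \<and> coprime t (p ^ e). xi (p ^ e) ^ (t * a)) \<in> \<int>"
proof -
  let ?D = "p ^ e" and ?E = "p ^ (e - 1)"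
  have DE: "?D = p * ?E" using e by (cases e) auto
  have p0: "p > 0" using p by (simp add: prime_gt_0_nat)
  have "xi ?D ^ (p * s) = xi ?E ^ s" for s
    unfolding xi_power DE using p0 by (simp add: mult_ac)
  then have "(\<Sum>s\<in>{0..<?E}. xi ?D ^ (p * s * a)) = (\<Sum>s\<in>{0..<?E}. xi ?E ^ (s * a))"
    by (simp add: mult.assoc)
  then have "(\<Sum>s\<in>{0..<?E}. xi ?D ^ (p * s * a)) \<in> \<int>"
    by (simp only: sum_xi_Ints)
  also have "(\<Sum>s\<in>{0..<?E}. xi ?D ^ (p * s * a)) = (\<Sum>t | t < ?D \<and> p dvd t. xi ?D ^ (t * a))"
    by (rule sum.reindex_bij_witness[of _ "\<lambda>t. t div p" "\<lambda>s. p * s"])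
      (use p0 in \<open>auto simp: DE less_mult_imp_div_less mult.commute\<close>)
  finally have 1: "(\<Sum>t | t < ?D \<and> p dvd t. xi ?D ^ (t * a)) \<in> \<int>" .
  have coprime: "coprime t ?D \<longleftrightarrow> \<not> p dvd t" for t
    using e prime_imp_coprime[OF p, of t] coprime_absorb_left[of p t] not_prime_unit[of p] p
    by (auto simp: coprime_power_right_iff coprime_commute[of t])
  have U: "{t. t < ?D \<and> coprime t ?D} = {0..<?D} - {t. t < ?D \<and> p dvd t}"
    unfolding coprime by auto
  have "(\<Sum>t | t < ?D \<and> coprime t ?D. xi ?D ^ (t * a))
      = (\<Sum>t\<in>{0..<?D}. xi ?D ^ (t * a)) - (\<Sum>t | t < ?D \<and> p dvd t. xi ?D ^ (t * a))"
    unfolding U by (rule sum_diff) auto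
  also have "\<dots> \<in> \<int>"
    by (intro Ints_diff sum_xi_Ints 1)
  finally show ?thesis .
qed

lemma cyclotomic_orbits_trace_Ints:
  assumes "prime p" and "e > 0" and "f \<in> cyclotomic_orbits (p ^ e)"
  shows "(\<Sum>t | t < p ^ e \<and> coprime t (p ^ e). f t) \<in> \<int>"
  using assms(3)
proof induction
  case (add_term f c a)
  then show ?case
    using ramanujan_sum_Ints[OF assms(1,2), of a]
    by (simp add: sum.distrib flip: sum_distrib_left)
qed simp

text \<open>
  All powers of \<open>x\<close> share the denominator \<open>N\<close>. This replaces the fact that a rational algebraic
  integer is an integer.
\<close>

lemma Ints_of_bounded_denominator:
  fixes x :: complex
  assumes "N > 0" and pow: "\<And>s. of_nat N * x ^ s \<in> \<int>"
  shows "x \<in> \<int>"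
proof -
  obtain z where "of_nat N * x = of_int z"
    using pow[of 1] by (auto elim: Ints_cases)
  then have "x = of_rat (of_int z / of_nat N)"
    using assms(1) by (simp add: of_rat_divide field_simps)
  moreover obtain a b where ab: "of_int z / of_nat N = Fract a b" "b > 0" "coprime a b"
    by (rule Rat_cases)
  ultimately have x: "x = of_int a / of_int b"
    by (simp add: of_rat_rat)
  \<comment> \<open>The exponent \<open>N\<close> suffices: \<open>b ^ N\<close> divides
    \<open>N\<close>, whereas \<open>b \<ge> 2\<close> would give \<open>b ^ N > N\<close>.\<close>
  obtain y where "of_nat N * x ^ N = of_int y"
    using pow[of N] by (auto elim: Ints_cases)
  then have "of_int (int N * a ^ N) = (of_int (y * b ^ N) :: complex)"
    using ab(2) by (simp add: x power_divide field_simps)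
  then have "b ^ N dvd int N * a ^ N"
    unfolding of_int_eq_iff by simp
  moreover have "coprime (b ^ N) (a ^ N)"
    using ab(3) by (simp add: coprime_commute)
  ultimately have "b ^ N dvd int N"
    by (simp add: coprime_dvd_mult_left_iff)
  then have "b ^ N \<le> int N"
    using assms(1) by (simp add: zdvd_imp_le)
  moreover have "int N < b ^ N" if "b \<ge> 2"
  proof -
    have "int N < 2 ^ N" by (simp add: of_nat_less_two_power)
    also have "\<dots> \<le> b ^ N" using that by (intro power_mono) auto
    finally show ?thesis .
  qed
  ultimately have "b = 1" using ab(2) by fastforce
  then show ?thesis by (simp add: x)
qed

text \<open>The traces of the powers of \<open>f\<close> are integers, and invariance turns them
  into \<open>card ?U * f 1 ^ s\<close>. Thus \<open>card ?U\<close> is a common denominator of all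
  powers.\<close>

lemma invariant_cyclotomic_orbit_Ints:
  assumes p: "prime p" "e > 0" and f: "f \<in> cyclotomic_orbits (p ^ e)"
    and inv: "\<And>t. coprime t (p ^ e) \<Longrightarrow> f t = f 1"
  shows "f 1 \<in> \<int>"
proof (rule Ints_of_bounded_denominator)
  let ?U = "{t. t < p ^ e \<and> coprime t (p ^ e)}"
  have "1 \<in> ?U"
    using one_less_power[OF prime_gt_1_nat[OF p(1)] p(2)] by (simp del: One_nat_def)
  then show "card ?U > 0"
    by (auto simp: card_gt_0_iff)
  fix s
  have "(\<Sum>t\<in>?U. f t ^ s) = (\<Sum>t\<in>?U. f 1 ^ s)"
    by (intro sum.cong refl arg_cong[where f = "\<lambda>z. z ^ s"] inv) blast
  also have "\<dots> = of_nat (card ?U) * f 1 ^ s"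
    by (rule sum_constant)
  finally show "of_nat (card ?U) * f 1 ^ s \<in> \<int>"
    using cyclotomic_orbits_trace_Ints[OF p cyclotomic_orbits_power[OF f, of s]] by (simp only:)
qed

text \<open>Multiplying by \<open>X - u\<close> combines two neighbouring coefficients, so the
  induction keeps \<open>i\<close> arbitrary.\<close>

lemma coeff_prod_linear_cyclotomic_orbits:
  assumes "finite A" and "\<And>a. a \<in> A \<Longrightarrow> u a \<in> cyclotomic_orbits D"
  shows "(\<lambda>t. coeff (\<Prod>a\<in>A. [:- u a t, 1:]) i) \<in> cyclotomic_orbits D"
  using assms
proof (induction A arbitrary: i rule: finite_induct)
  case empty
  then show ?case
    using cyclotomic_orbits_const[of "if i = 0 then 1 else 0" D] by (cases i) simp_all
next
  case (insert a A)
  have "(\<lambda>t. case i of 0 \<Rightarrow> 0 | Suc j \<Rightarrow> coeff (\<Prod>a\<in>A. [:- u a t, 1:]) j) \<in> cyclotomic_orbits D"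
    using insert cyclotomic_orbits.zero by (cases i) simp_all
  moreover have "(\<lambda>t. - u a t * coeff (\<Prod>a\<in>A. [:- u a t, 1:]) i) \<in> cyclotomic_orbits D"
    using insert by (intro cyclotomic_orbits_mult cyclotomic_orbits_uminus) auto
  moreover have "coeff (\<Prod>a\<in>insert a A. [:- u a t, 1:]) i
      = - u a t * coeff (\<Prod>a\<in>A. [:- u a t, 1:]) i
        + (case i of 0 \<Rightarrow> 0 | Suc j \<Rightarrow> coeff (\<Prod>a\<in>A. [:- u a t, 1:]) j)" for t
    using insert(1,2) by (simp add: coeff_pCons)
  ultimately show ?case
    by (simp only: cyclotomic_orbits_add)
qed

section \<open>Invariance of the characteristic polynomial under conjugation\<close>

lemma bij_betw_mult_mod:
  fixes t D :: nat
  assumes "coprime t D"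
  shows "bij_betw (\<lambda>x. t * x mod D) {0..<D} {0..<D}"
proof -
  have *: "x = y" if "x \<le> y" "y < D" "t * x mod D = t * y mod D" for x y
  proof -
    have "D dvd t * y - t * x"
      using that by (metis mod_eq_dvd_iff_nat mult_le_mono2)
    then have "D dvd y - x"
      using assms by (simp add: coprime_dvd_mult_right_iff coprime_commute flip: diff_mult_distrib2)
    then show ?thesis
      using that by (auto dest: dvd_imp_le)
  qed
  have "inj_on (\<lambda>x. t * x mod D) {0..<D}"
    by (rule inj_onI) (metis * atLeastLessThan_iff nat_le_linear)
  moreover have "(\<lambda>x. t * x mod D) ` {0..<D} \<subseteq> {0..<D}" by auto
  ultimately show ?thesis
    unfolding bij_betw_def by (intro conjI endo_inj_surj) simp_all
qed

text \<open>Raising \<open>xi D\<close> to the power \<open>t\<close> permutes the exponents by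
  \<open>x -> t x mod D\<close>.\<close>

lemma prod_decreasing_tuples_conjugate:
  fixes F :: "complex \<Rightarrow> 'c::comm_monoid_mult"
  assumes "D > 0" and "coprime t D"
  shows "(\<Prod>a\<in>decreasing_tuples N D. F (\<Sum>i = 1..N. xi D ^ (t * a i)))
    = (\<Prod>a\<in>decreasing_tuples N D. F (\<Sum>i = 1..N. xi D ^ a i))"
  using prod_decreasing_tuples_permuted[OF bij_betw_mult_mod[OF assms(2)], of F "\<lambda>x. xi D ^ x" N]
  by (simp only: xi_power_mod[OF assms(1)])

lemma char_poly_coeff_Ints:
  assumes p: "prime p"
  shows "coeff (char_poly p r k) i \<in> \<int>"
proof -
  obtain e where D: "period p k = p ^ e" "e > 0"
    unfolding period_def by force
  let ?A = "decreasing_tuples (p ^ r - 1) (p ^ e)"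
  \<comment> \<open>\<open>f 1\<close> is the coefficient itself, \<open>f t\<close> the result of
    replacing \<open>xi (p ^ e)\<close> by its \<open>t\<close>-th power.\<close>
  define f where "f t = coeff (\<Prod>a\<in>?A. [:- (1 + (\<Sum>i = 1..p ^ r - 1. xi (p ^ e) ^ (t * a i))), 1:]) i" for t
  have "(\<lambda>t. 1 + (\<Sum>i = 1..p ^ r - 1. xi (p ^ e) ^ (t * a i))) \<in> cyclotomic_orbits (p ^ e)" for a
    using cyclotomic_orbits_const[of 1]
    by (intro cyclotomic_orbits_add cyclotomic_orbits_sum cyclotomic_orbits_xi) simp
  then have "f \<in> cyclotomic_orbits (p ^ e)"
    unfolding f_def[abs_def] by (intro coeff_prod_linear_cyclotomic_orbits finite_decreasing_tuples)
  moreover have "f t = f 1" if "coprime t (p ^ e)" for t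
    using prod_decreasing_tuples_conjugate[OF _ that, of "\<lambda>s. [:- (1 + s), 1:]"] p
    by (simp add: f_def prime_gt_0_nat)
  ultimately have "f 1 \<in> \<int>"
    using invariant_cyclotomic_orbit_Ints[OF p D(2)] by blast
  then show ?thesis
    by (simp add: f_def char_poly_def D Let_def)
qed

subsection \<open>The exponential sum\<close>

text \<open>The exponential sum involves inverse powers of \<open>xi D\<close>, the polynomial
  positive ones; conjugating with \<open>t = D - 1\<close>, which is -1 modulo \<open>D\<close>,
  reconciles them.\<close>

lemma poly_char_poly_eq_0:
  assumes p: "prime p" and j: "j \<in> decreasing_tuples (p ^ r - 1) (period p k)"
  shows "poly (char_poly p r k) (1 + (\<Sum>i = 1..p ^ r - 1. inverse (xi (period p k)) ^ j i)) = 0"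
proof -
  let ?D = "period p k" and ?N = "p ^ r - 1"
  let ?z = "1 + (\<Sum>i = 1..?N. inverse (xi ?D) ^ j i)"
  have D: "?D > 0"
    using p by (simp add: period_def prime_gt_0_nat)
  have inv: "xi ?D ^ ((?D - 1) * n) = inverse (xi ?D) ^ n" for n
  proof -
    have "xi ?D ^ ((?D - 1) * n) * xi ?D ^ n = xi ?D ^ (?D * n)"
      using D by (cases ?D) (simp_all flip: power_add add: algebra_simps)
    also have "\<dots> = 1"
      using xi_power_eq_iff[OF D, of "?D * n" 0] by simp
    finally show ?thesis
      by (simp add: field_simps)
  qed
  have "coprime (?D - 1) ?D"
    using D by (rule coprime_diff_one_left_nat)
  from prod_decreasing_tuples_conjugate[OF D this, of "\<lambda>s. [:- (1 + s), 1:]" ?N]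
  have "char_poly p r k = (\<Prod>a\<in>decreasing_tuples ?N ?D. [:- (1 + (\<Sum>i = 1..?N. inverse (xi ?D) ^ a i)), 1:])"
    by (simp only: char_poly_def Let_def inv)
  then show ?thesis
    using j by (auto simp: poly_prod prod_zero_iff)
qed

text \<open>Each geometric sequence \<open>l j ^ n\<close> with \<open>l j\<close> a root of
  \<open>P\<close> solves the recurrence, and the solutions form a linear space.\<close>

lemma satisfies_recurrence_exp_poly:
  assumes "finite J" and "lead_coeff P = 1" and root: "\<And>j. j \<in> J \<Longrightarrow> poly P (l j) = 0"
    and s: "\<And>n. s n = (\<Sum>j\<in>J. c j * l j ^ n)"
  shows "satisfies_recurrence s P"
  unfolding satisfies_recurrence_def
proof (intro conjI allI impI)
  fix n :: nat
  have "s (n + degree P) + (\<Sum>i<degree P. coeff P i * s (n + i)) = (\<Sum>i\<le>degree P. coeff P i * s (n + i))"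
    using assms(2) by (simp flip: lessThan_Suc_atMost)
  also have "\<dots> = (\<Sum>j\<in>J. \<Sum>i\<le>degree P. coeff P i * (c j * l j ^ (n + i)))"
    unfolding s sum_distrib_left by (rule sum.swap)
  also have "\<dots> = (\<Sum>j\<in>J. c j * l j ^ n * poly P (l j))"
    unfolding poly_altdef sum_distrib_left
    by (intro sum.cong refl) (simp add: power_add)
  also have "\<dots> = 0"
    by (simp add: root)
  finally show "s (n + degree P) = - (\<Sum>i<degree P. coeff P i * s (n + i))"
    by (simp add: eq_neg_iff_add_eq_0)
qed (use assms in simp)

lemma exp_sum_elem_sym:
  fixes \<alpha> :: "nat \<Rightarrow> 'a::{field,finite}"
  assumes p: "prime p" and q: "CARD('a) = p ^ r"
    and \<alpha>: "bij_betw \<alpha> {1..p ^ r - 1} (UNIV - {0})" and "k > 0"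
  shows "exp_sum p r n (elem_sym n k :: (nat \<Rightarrow> 'a) \<Rightarrow> 'a) =
    (\<Sum>j\<in>decreasing_tuples (p ^ r - 1) (period p k).
       fourier_coeff p r \<alpha> k j * (1 + (\<Sum>i = 1..p ^ r - 1. inverse (xi (period p k)) ^ j i)) ^ n)"
proof -
  define N where "N = p ^ r - 1"
  define D where "D = period p k"
  \<comment> \<open>\<open>H\<close> is the function to be expanded, \<open>G\<close> gives its
    Fourier coefficients, and \<open>l j\<close> is the sum of the weights that \<open>j\<close>
    assigns to the field elements.\<close>
  define H where "H b = xi p ^ Tr p r (Fk p r \<alpha> k (\<lambda>i. int (b i)))" for b
  define m where "m x i = card {t \<in> {1..n}. x t = \<alpha> i}" for x :: "nat \<Rightarrow> 'a" and i
  define G where "G j = 1 / of_nat D ^ N *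
    (\<Sum>b\<in>tuples N D. H b * xi D ^ (\<Sum>i = 1..N. j i * b (Suc N - i)))" for j
  define l where "l j = 1 + (\<Sum>i = 1..N. inverse (xi D) ^ j i)" for j
  have D: "D > 0"
    using p by (simp add: D_def period_def prime_gt_0_nat)
  have Suc_N: "Suc N = p ^ r"
    using p by (simp add: N_def prime_gt_0_nat)
  have summand: "exp (2 * of_real pi * \<i> / of_nat p * of_nat (Tr p r (elem_sym n k x)))
      = H (\<lambda>i\<in>{1..N}. m x i mod D)" for x :: "nat \<Rightarrow> 'a"
  proof -
    have "elem_sym n k x = Fk p r \<alpha> k (\<lambda>i. int ((\<lambda>i\<in>{1..N}. m x i mod D) i))"
      by (rule elem_sym_eq_Fk[OF p q \<open>k > 0\<close> \<alpha>]) (simp add: N_def D_def m_def)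
    then show ?thesis
      by (simp add: H_def xi_power)
  qed
  \<comment> \<open>The pairing of \<open>j i\<close> with entry \<open>N + 1 - i\<close> is
    reversed, so that \<open>\<alpha> i\<close> gets the weight of frequency
    \<open>j (Suc N - i)\<close>.\<close>
  have rev: "(\<Prod>i = 1..N. inverse (xi D) ^ (j i * m x (Suc N - i)))
      = (\<Prod>i = 1..N. (inverse (xi D) ^ j (Suc N - i)) ^ m x i)" for j x
    using prod.atLeastAtMost_rev[of "\<lambda>i. inverse (xi D) ^ (j i * m x (Suc N - i))" 1 N]
    by (simp add: power_mult)
  have rev_sum: "(\<Sum>i = 1..N. inverse (xi D) ^ j (Suc N - i)) = (\<Sum>i = 1..N. inverse (xi D) ^ j i)" for j
    using sum.atLeastAtMost_rev[of "\<lambda>i. inverse (xi D) ^ j i" 1 N] by simp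
  have "exp_sum p r n (elem_sym n k :: (nat \<Rightarrow> 'a) \<Rightarrow> 'a)
      = (\<Sum>x\<in>{1..n} \<rightarrow>\<^sub>E UNIV. H (\<lambda>i\<in>{1..N}. m x i mod D))"
    by (simp only: exp_sum_def summand)
  also have "\<dots> = (\<Sum>x\<in>{1..n} \<rightarrow>\<^sub>E UNIV. \<Sum>j\<in>tuples N D.
      G j * (\<Prod>i = 1..N. (inverse (xi D) ^ j (Suc N - i)) ^ m x i))"
    unfolding G_def fourier_inversion[OF D] rev ..
  also have "\<dots> = (\<Sum>j\<in>tuples N D. \<Sum>x\<in>{1..n} \<rightarrow>\<^sub>E UNIV.
      G j * (\<Prod>i = 1..N. (inverse (xi D) ^ j (Suc N - i)) ^ m x i))"
    by (rule sum.swap)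
  also have "\<dots> = (\<Sum>j\<in>tuples N D. G j * l j ^ n)"
    unfolding m_def sum_distrib_left[symmetric] sum_prod_fibres[OF \<alpha>[folded N_def]] rev_sum l_def ..
  also have "\<dots> = (\<Sum>j\<in>decreasing_tuples N D. \<Sum>j'\<in>Sym N j. G j' * l j' ^ n)"
    by (rule sum_tuples_by_Sym)
  also have "\<dots> = (\<Sum>j\<in>decreasing_tuples N D. fourier_coeff p r \<alpha> k j * l j ^ n)"
  proof (rule sum.cong[OF refl])
    fix j assume "j \<in> decreasing_tuples N D"
    then have "j \<in> tuples N D" by (simp add: decreasing_tuples_def)
    \<comment> \<open>\<open>l\<close> is constant on rearrangement classes, so its power leaves the
      inner sum.\<close>
    moreover have "l j = 1 + (\<Sum>x\<in>#tuple_mset N j. inverse (xi D) ^ x)" for j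
      by (simp add: l_def sum_unfold_sum_mset multiset.map_comp comp_def)
    ultimately have "l j' = l j" if "j' \<in> Sym N j" for j'
      using that by (simp only: mem_Sym_iff)
    moreover have "(\<Sum>j'\<in>Sym N j. G j') = fourier_coeff p r \<alpha> k j"
      unfolding G_def sum_distrib_left[symmetric] fourier_coeff_def Let_def H_def
        N_def[symmetric] D_def[symmetric] Suc_N[symmetric]
      by (subst sum.swap) (simp add: sum_distrib_left)
    ultimately show "(\<Sum>j'\<in>Sym N j. G j' * l j' ^ n) = fourier_coeff p r \<alpha> k j * l j ^ n"
      by (simp flip: sum_distrib_right)
  qed
  finally show ?thesis
    by (simp only: l_def N_def D_def)
qed

theorem theorem4p11:
  fixes p r k :: nat and \<alpha> :: "nat \<Rightarrow> 'a::{field,finite}"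
  assumes "prime p" and "r \<ge> 1" and "CARD('a) = p ^ r"
    and "bij_betw \<alpha> {1..p ^ r - 1} (UNIV - {0})"
    and "k > 1"
  shows "(\<forall>n\<ge>1. exp_sum p r n (elem_sym n k :: (nat \<Rightarrow> 'a) \<Rightarrow> 'a) =
            (\<Sum>j\<in>decreasing_tuples (p ^ r - 1) (period p k).
               fourier_coeff p r \<alpha> k j *
               (1 + (\<Sum>i = 1..p ^ r - 1. xi (period p k) powi (- int (j i)))) ^ n)) \<and>
         (\<forall>i. coeff (char_poly p r k) i \<in> \<int>) \<and>
         satisfies_recurrence (\<lambda>n. exp_sum p r n (elem_sym n k :: (nat \<Rightarrow> 'a) \<Rightarrow> 'a)) (char_poly p r k)"
proof (intro conjI allI impI)
  have k: "k > 0" using assms by simp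
  note exp_sum = exp_sum_elem_sym[OF assms(1,3,4) k]
  show "exp_sum p r n (elem_sym n k :: (nat \<Rightarrow> 'a) \<Rightarrow> 'a) =
    (\<Sum>j\<in>decreasing_tuples (p ^ r - 1) (period p k).
       fourier_coeff p r \<alpha> k j *
       (1 + (\<Sum>i = 1..p ^ r - 1. xi (period p k) powi (- int (j i)))) ^ n)" for n
    by (simp add: exp_sum power_int_minus power_inverse)
  show "coeff (char_poly p r k) i \<in> \<int>" for i
    by (rule char_poly_coeff_Ints[OF assms(1)])
  have "lead_coeff (char_poly p r k) = 1"
    by (simp add: char_poly_def Let_def lead_coeff_prod)
  then show "satisfies_recurrence (\<lambda>n. exp_sum p r n (elem_sym n k :: (nat \<Rightarrow> 'a) \<Rightarrow> 'a)) (char_poly p r k)"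
    using poly_char_poly_eq_0[OF assms(1)] exp_sum
    by (intro satisfies_recurrence_exp_poly[OF finite_decreasing_tuples]) auto
qed

end
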